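(* Let $c\neq 0$ and $\lambda>0$ be real constants, let $I\subset\mathbb{R}$ be an open interval on which $\cos\left(\frac{u}{c}\right)\neq0$ and $1-\frac{\lambda^2}{c^2}\sin^2\left(\frac{u}{c}\right)>0$, and let $\alpha:I\to\mathbb{R}$ be a smooth function. Let $M$ be the generalized spherical surface of first kind in $\mathbb{E}^4$ determined by $c,\lambda,\alpha$. Then, with respect to the orthonormal normal frame $N_1,N_2$ given in the context, the mean curvature vector of $M$ is $$\overrightarrow{H}=\frac12\left\{\left(\frac{\kappa^2c^2+1}{c^2\kappa}\right)N_1-\frac{\kappa_1}{\kappa\lambda\cos\left(\frac{u}{c}\right)}N_2\right\},$$ where $$\kappa=\sqrt{(\varphi')^2+\varphi^2\left((\alpha')^2+\frac{1}{c^2}\right)+\frac{\lambda^2}{c^4}\left(1-\frac{c^2}{\lambda^2}\right)},\qquad \kappa_1=\varphi^2\alpha',\qquad \varphi=\sqrt{1-\frac{\lambda^2}{c^2}\sin^2\left(\frac{u}{c}\right)}.$$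
   Context: The generalized spherical surface of first kind determined by $c,\lambda,\alpha$ is the surface in $\mathbb{E}^4$ given by the patch $$X(u,v)=\left(f_1(u),\ f_2(u),\ \lambda\cos\left(\tfrac{u}{c}\right)\cos v,\ \lambda\cos\left(\tfrac{u}{c}\right)\sin v\right),\qquad u\in I,\ v\in\mathbb{R},$$ where $f_1(u)=\int\sqrt{1-\frac{\lambda^2}{c^2}\sin^2\left(\frac{u}{c}\right)}\cos\alpha(u)\,du$ and $f_2(u)=\int\sqrt{1-\frac{\lambda^2}{c^2}\sin^2\left(\frac{u}{c}\right)}\sin\alpha(u)\,du$ (any antiderivatives). The functions in the claim are the curvature $\kappa=\sqrt{(f_1'')^2+(f_2'')^2+\frac{\lambda^2}{c^4}\cos^2\left(\frac{u}{c}\right)}$ of the profile curve $\gamma(u)=\left(f_1(u),f_2(u),\lambda\cos\left(\frac uc\right)\right)$ and $\kappa_1=f_1'f_2''-f_1''f_2'$. The orthonormal normal frame is $$N_1=\frac1\kappa\left(f_1'',\ f_2'',\ -\tfrac{\lambda}{c^2}\cos\left(\tfrac uc\right)\cos v,\ -\tfrac{\lambda}{c^2}\cos\left(\tfrac uc\right)\sin v\right),$$ $$N_2=\frac1\kappa\left(-\tfrac{\lambda f_2'}{c^2}\cos\left(\tfrac uc\right)+\tfrac{\lambda f_2''}{c}\sin\left(\tfrac uc\right),\ -\tfrac{\lambda f_1''}{c}\sin\left(\tfrac uc\right)+\tfrac{\lambda f_1'}{c^2}\cos\left(\tfrac uc\right),\ \kappa_1\cos v,\ \kappa_1\sin v\right).$$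 For a regular patch in $\mathbb{E}^4$ with $g_{11}=\langle X_u,X_u\rangle$, $g_{12}=\langle X_u,X_v\rangle$, $g_{22}=\langle X_v,X_v\rangle$, $W^2=g_{11}g_{22}-g_{12}^2\neq0$, and $L_{11}^k=\langle X_{uu},N_k\rangle$, $L_{12}^k=\langle X_{uv},N_k\rangle$, $L_{22}^k=\langle X_{vv},N_k\rangle$, the mean curvature vector is $\overrightarrow{H}=\frac{1}{2W^2}\sum_{k=1}^{2}\left(L_{11}^kg_{22}+L_{22}^kg_{11}-2L_{12}^kg_{12}\right)N_k$. *)

theory Defs
  imports "HOL-Analysis.Analysis"
begin

text \<open>Iterated \<open>deriv\<close> is a local notion, so for an open set \<open>S\<close> this depends only on
  the values of \<open>f\<close> on \<open>S\<close> and is the usual notion of a smooth function on \<open>S\<close>.\<close>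

definition smooth_on_open :: "real set \<Rightarrow> (real \<Rightarrow> real) \<Rightarrow> bool" where
  "smooth_on_open S f \<longleftrightarrow> open S \<and> (\<forall>n. (deriv ^^ n) f differentiable_on S)"

definition partial_u :: "(real \<Rightarrow> real \<Rightarrow> real^4) \<Rightarrow> real \<Rightarrow> real \<Rightarrow> real^4" where
  "partial_u X u v = vector_derivative (\<lambda>s. X s v) (at u)"

definition partial_v :: "(real \<Rightarrow> real \<Rightarrow> real^4) \<Rightarrow> real \<Rightarrow> real \<Rightarrow> real^4" where
  "partial_v X u v = vector_derivative (\<lambda>t. X u t) (at v)"

definition g11 :: "(real \<Rightarrow> real \<Rightarrow> real^4) \<Rightarrow> real \<Rightarrow> real \<Rightarrow> real" where
  "g11 X u v = partial_u X u v \<bullet> partial_u X u v"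

definition g12 :: "(real \<Rightarrow> real \<Rightarrow> real^4) \<Rightarrow> real \<Rightarrow> real \<Rightarrow> real" where
  "g12 X u v = partial_u X u v \<bullet> partial_v X u v"

definition g22 :: "(real \<Rightarrow> real \<Rightarrow> real^4) \<Rightarrow> real \<Rightarrow> real \<Rightarrow> real" where
  "g22 X u v = partial_v X u v \<bullet> partial_v X u v"

definition W2 :: "(real \<Rightarrow> real \<Rightarrow> real^4) \<Rightarrow> real \<Rightarrow> real \<Rightarrow> real" where
  "W2 X u v = g11 X u v * g22 X u v - (g12 X u v)\<^sup>2"

definition L11 :: "(real \<Rightarrow> real \<Rightarrow> real^4) \<Rightarrow> (real \<Rightarrow> real \<Rightarrow> real^4) \<Rightarrow> real \<Rightarrow> real \<Rightarrow> real" where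
  "L11 X N u v = partial_u (partial_u X) u v \<bullet> N u v"

definition L12 :: "(real \<Rightarrow> real \<Rightarrow> real^4) \<Rightarrow> (real \<Rightarrow> real \<Rightarrow> real^4) \<Rightarrow> real \<Rightarrow> real \<Rightarrow> real" where
  "L12 X N u v = partial_v (partial_u X) u v \<bullet> N u v"

definition L22 :: "(real \<Rightarrow> real \<Rightarrow> real^4) \<Rightarrow> (real \<Rightarrow> real \<Rightarrow> real^4) \<Rightarrow> real \<Rightarrow> real \<Rightarrow> real" where
  "L22 X N u v = partial_v (partial_v X) u v \<bullet> N u v"

definition orthonormal_normal_frame ::
  "(real \<Rightarrow> real \<Rightarrow> real^4) \<Rightarrow> (real \<Rightarrow> real \<Rightarrow> real^4) \<Rightarrow> (real \<Rightarrow> real \<Rightarrow> real^4)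
    \<Rightarrow> real \<Rightarrow> real \<Rightarrow> bool" where
  "orthonormal_normal_frame X N1 N2 u v \<longleftrightarrow>
     norm (N1 u v) = 1 \<and> norm (N2 u v) = 1 \<and> N1 u v \<bullet> N2 u v = 0 \<and>
     partial_u X u v \<bullet> N1 u v = 0 \<and> partial_v X u v \<bullet> N1 u v = 0 \<and>
     partial_u X u v \<bullet> N2 u v = 0 \<and> partial_v X u v \<bullet> N2 u v = 0"

text \<open>Meaningful where \<open>W2 X u v \<noteq> 0\<close> and \<open>N1\<close>, \<open>N2\<close> form an orthonormal normal frame.\<close>

definition mean_curvature_vector ::
  "(real \<Rightarrow> real \<Rightarrow> real^4) \<Rightarrow> (real \<Rightarrow> real \<Rightarrow> real^4) \<Rightarrow> (real \<Rightarrow> real \<Rightarrow> real^4)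
    \<Rightarrow> real \<Rightarrow> real \<Rightarrow> real^4" where
  "mean_curvature_vector X N1 N2 u v =
     (1 / (2 * W2 X u v)) *\<^sub>R
       (\<Sum>N\<leftarrow>[N1, N2].
          (L11 X N u v * g22 X u v + L22 X N u v * g11 X u v
             - 2 * L12 X N u v * g12 X u v) *\<^sub>R N u v)"

definition phi :: "real \<Rightarrow> real \<Rightarrow> real \<Rightarrow> real" where
  "phi c l u = sqrt (1 - l\<^sup>2 / c\<^sup>2 * (sin (u / c))\<^sup>2)"

definition spherical_patch ::
  "real \<Rightarrow> real \<Rightarrow> (real \<Rightarrow> real) \<Rightarrow> (real \<Rightarrow> real) \<Rightarrow> real \<Rightarrow> real \<Rightarrow> real^4" where
  "spherical_patch c l f1 f2 u v =
     vector [f1 u, f2 u, l * cos (u / c) * cos v, l * cos (u / c) * sin v]"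

text \<open>The generalized spherical surface of first kind determined by \<open>c\<close>, \<open>l\<close>, \<open>\<alpha>\<close> over \<open>I\<close>
  is determined only up to the choice of the two antiderivatives \<open>f1\<close> and \<open>f2\<close>.\<close>

definition spherical_coordinates ::
  "real \<Rightarrow> real \<Rightarrow> (real \<Rightarrow> real) \<Rightarrow> real set \<Rightarrow> (real \<Rightarrow> real) \<Rightarrow> (real \<Rightarrow> real) \<Rightarrow> bool" where
  "spherical_coordinates c l \<alpha> I f1 f2 \<longleftrightarrow>
     (\<forall>u\<in>I. (f1 has_real_derivative phi c l u * cos (\<alpha> u)) (at u)) \<and>
     (\<forall>u\<in>I. (f2 has_real_derivative phi c l u * sin (\<alpha> u)) (at u))"

definition kappa :: "real \<Rightarrow> real \<Rightarrow> (real \<Rightarrow> real) \<Rightarrow> (real \<Rightarrow> real) \<Rightarrow> real \<Rightarrow> real" where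
  "kappa c l f1 f2 u =
     sqrt ((deriv (deriv f1) u)\<^sup>2 + (deriv (deriv f2) u)\<^sup>2 + l\<^sup>2 / c ^ 4 * (cos (u / c))\<^sup>2)"

definition kappa1 :: "(real \<Rightarrow> real) \<Rightarrow> (real \<Rightarrow> real) \<Rightarrow> real \<Rightarrow> real" where
  "kappa1 f1 f2 u = deriv f1 u * deriv (deriv f2) u - deriv (deriv f1) u * deriv f2 u"

definition normal1 ::
  "real \<Rightarrow> real \<Rightarrow> (real \<Rightarrow> real) \<Rightarrow> (real \<Rightarrow> real) \<Rightarrow> real \<Rightarrow> real \<Rightarrow> real^4" where
  "normal1 c l f1 f2 u v =
     (1 / kappa c l f1 f2 u) *\<^sub>R
       vector [deriv (deriv f1) u,
               deriv (deriv f2) u,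
               - (l / c\<^sup>2) * cos (u / c) * cos v,
               - (l / c\<^sup>2) * cos (u / c) * sin v]"

definition normal2 ::
  "real \<Rightarrow> real \<Rightarrow> (real \<Rightarrow> real) \<Rightarrow> (real \<Rightarrow> real) \<Rightarrow> real \<Rightarrow> real \<Rightarrow> real^4" where
  "normal2 c l f1 f2 u v =
     (1 / kappa c l f1 f2 u) *\<^sub>R
       vector [- (l * deriv f2 u / c\<^sup>2) * cos (u / c) + l * deriv (deriv f2) u / c * sin (u / c),
               - (l * deriv (deriv f1) u / c) * sin (u / c) + l * deriv f1 u / c\<^sup>2 * cos (u / c),
               kappa1 f1 f2 u * cos v,
               kappa1 f1 f2 u * sin v]"

end

theory Submission imports Defs begin

text \<open>
  The surface is swept out by rotating the profile curve
  \<open>\<gamma> = (f1, f2, r)\<close>, \<open>r u = l * cos (u / c)\<close>, about the plane of the first two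
  coordinates. For fixed \<open>v\<close> the rotation is a linear isometric embedding
  \<open>meridian_embedding v\<close> of three-space into four-space; it commutes with differentiation
  in \<open>u\<close>, and its image is orthogonal to the direction of the parallels. Hence \<open>X\<^sub>u\<close>, \<open>X\<^sub>u\<^sub>u\<close> and the
  frame \<open>N1\<close>, \<open>N2\<close> are the images of \<open>\<gamma>'\<close>, \<open>\<gamma>''\<close>, of the principal
  normal \<open>\<gamma>'' / \<kappa>\<close> and of the binormal \<open>\<gamma>' \<times> \<gamma>'' / \<kappa>\<close>, while
  \<open>X\<^sub>v\<^sub>v\<close> is the image of \<open>(0, 0, - r)\<close>.

  The integrand \<open>\<phi>\<close> is chosen to make \<open>\<gamma>\<close> unit speed:
  \<open>\<phi>\<^sup>2 + r'\<^sup>2 = 1\<close>. Differentiating, \<open>\<gamma>' \<bullet> \<gamma>'' = 0\<close>, so the frame is orthonormal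
  and normal, \<open>g11 = 1\<close>, \<open>g12 = 0\<close>, \<open>g22 = r\<^sup>2\<close>, and
  \<^item> along the meridian, \<open>X\<^sub>u\<^sub>u = \<kappa> N1\<close> has component \<open>\<kappa>\<close> along \<open>N1\<close> and none along \<open>N2\<close>;
  \<^item> along the parallel, \<open>X\<^sub>v\<^sub>v\<close> has component \<open>- r r'' / \<kappa>\<close> along \<open>N1\<close> and
    \<open>- r \<kappa>1 / \<kappa>\<close> along \<open>N2\<close>, \<open>\<kappa>1\<close> being the last component of
    \<open>\<gamma>' \<times> \<gamma>''\<close>.

  This gives the mean curvature of any surface of this kind with a unit-speed profile
  (\<open>rotation_partial_derivatives\<close>, \<open>rotation_mean_curvature\<close>); the stated formula is the case \<open>r'' = - r / c\<^sup>2\<close>. The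
  expressions for \<open>\<kappa>\<close> and \<open>\<kappa>1\<close> come from reading
  \<open>(f1', f2') = \<phi> (cos \<alpha>, sin \<alpha>)\<close> in polar form, so that \<open>(f1'', f2'')\<close> has
  radial component \<open>\<phi>'\<close> and angular component \<open>\<phi> \<alpha>'\<close>.
\<close>

section \<open>Rotating three-space into four-space\<close>

text \<open>The image for fixed \<open>v\<close> is spanned by the first two axes and \<open>(0, 0, cos v, sin v)\<close>; it
  contains the meridian \<open>v\<close> of every surface of rotation about the plane of these axes.\<close>

definition meridian_embedding :: "real \<Rightarrow> real \<Rightarrow> real \<Rightarrow> real \<Rightarrow> real^4" where
  "meridian_embedding v x y r = vector [x, y, r * cos v, r * sin v]"

definition parallel_direction :: "real \<Rightarrow> real^4" where
  "parallel_direction v = vector [0, 0, - sin v, cos v]"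

lemma vector_4:
  "(vector [a, b, c, d] :: real^4) $ 1 = a" "(vector [a, b, c, d] :: real^4) $ 2 = b"
  "(vector [a, b, c, d] :: real^4) $ 3 = c" "(vector [a, b, c, d] :: real^4) $ 4 = d"
  by (simp_all add: vector_def)

lemma inner_vector_4:
  "(vector [a, b, c, d] :: real^4) \<bullet> vector [a', b', c', d'] = a*a' + b*b' + c*c' + d*d'"
  by (simp add: inner_vec_def sum_4 vector_4)

lemma meridian_inner_meridian:
  "meridian_embedding v x y r \<bullet> meridian_embedding v x' y' r' = x * x' + y * y' + r * r'"
proof -
  have "meridian_embedding v x y r \<bullet> meridian_embedding v x' y' r' =
      x * x' + y * y' + r * r' * ((cos v)\<^sup>2 + (sin v)\<^sup>2)"
    unfolding meridian_embedding_def inner_vector_4 by algebra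
  then show ?thesis by simp
qed

lemma parallel_direction_inner_meridian: "parallel_direction v \<bullet> meridian_embedding v x y r = 0"
  unfolding meridian_embedding_def parallel_direction_def inner_vector_4 by simp

lemma norm_parallel_direction: "parallel_direction v \<bullet> parallel_direction v = 1"
  unfolding parallel_direction_def inner_vector_4
  by (simp flip: power2_eq_square)

lemma vector_4_has_vector_derivative:
  fixes a b c d :: "real \<Rightarrow> real"
  assumes "(a has_real_derivative a') (at t)" "(b has_real_derivative b') (at t)"
    and "(c has_real_derivative c') (at t)" "(d has_real_derivative d') (at t)"
  shows "((\<lambda>t. vector [a t, b t, c t, d t] :: real^4) has_vector_derivative
      vector [a', b', c', d']) (at t)"
proof -
  have expand: "(vector [a, b, c, d] :: real^4) =
      a *\<^sub>R axis 1 1 + b *\<^sub>R axis 2 1 + c *\<^sub>R axis 3 1 + d *\<^sub>R axis 4 1" for a b c d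
    by (simp add: vec_eq_iff forall_4 vector_4 axis_def)
  have "((\<lambda>t. f t *\<^sub>R e) has_vector_derivative f' *\<^sub>R e) (at t)"
    if "(f has_real_derivative f') (at t)" for f f' and e :: "real^4"
    using has_vector_derivative_scaleR[OF that has_vector_derivative_const[of e]] by simp
  with assms show ?thesis
    unfolding expand by (intro has_vector_derivative_add) auto
qed

lemma meridian_has_vector_derivative:
  assumes "(x has_real_derivative x') (at u)" "(y has_real_derivative y') (at u)"
    and "(r has_real_derivative r') (at u)"
  shows "((\<lambda>s. meridian_embedding v (x s) (y s) (r s)) has_vector_derivative
      meridian_embedding v x' y' r') (at u)"
  unfolding meridian_embedding_def
  by (intro vector_4_has_vector_derivative DERIV_cmult_right assms)

lemma meridian_has_vector_derivative_angle:
  "((\<lambda>t. meridian_embedding t x y r) has_vector_derivative r *\<^sub>R parallel_direction v) (at v)"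
proof -
  have "((\<lambda>t. meridian_embedding t x y r) has_vector_derivative
      vector [0, 0, r * - sin v, r * cos v]) (at v)"
    unfolding meridian_embedding_def
    by (intro vector_4_has_vector_derivative DERIV_cmult DERIV_const DERIV_sin DERIV_cos)
  also have "vector [0, 0, r * - sin v, r * cos v] = r *\<^sub>R parallel_direction v"
    by (simp add: parallel_direction_def vec_eq_iff forall_4 vector_4)
  finally show ?thesis .
qed

lemma parallel_direction_has_vector_derivative:
  "(parallel_direction has_vector_derivative meridian_embedding v 0 0 (- 1)) (at v)"
proof -
  have "(parallel_direction has_vector_derivative vector [0, 0, - cos v, - sin v]) (at v)"
    unfolding parallel_direction_def[abs_def]
    by (intro vector_4_has_vector_derivative DERIV_minus DERIV_const DERIV_sin DERIV_cos)
  then show ?thesis by (simp add: meridian_embedding_def)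
qed

lemma scaleR_meridian:
  "a *\<^sub>R meridian_embedding v x y r = meridian_embedding v (a * x) (a * y) (a * r)"
  unfolding meridian_embedding_def by (simp add: vec_eq_iff forall_4 vector_4)

section \<open>Surfaces swept out by a unit-speed profile curve\<close>

text \<open>\<open>X\<^sub>u\<^sub>u\<close> at \<open>u\<close> depends on \<open>X\<^sub>u\<close> near \<open>u\<close>; hence the first derivatives of the profile
  are given on an open set, the second ones at the point.\<close>

lemma rotation_partial_derivatives:
  fixes x y r x1 y1 r1 :: "real \<Rightarrow> real"
  defines "X \<equiv> \<lambda>u v. meridian_embedding v (x u) (y u) (r u)"
  assumes "open I" "u \<in> I"
    and d1: "\<And>s. s \<in> I \<Longrightarrow> (x has_real_derivative x1 s) (at s)"
      "\<And>s. s \<in> I \<Longrightarrow> (y has_real_derivative y1 s) (at s)"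
      "\<And>s. s \<in> I \<Longrightarrow> (r has_real_derivative r1 s) (at s)"
    and d2: "(x1 has_real_derivative x2) (at u)" "(y1 has_real_derivative y2) (at u)"
      "(r1 has_real_derivative r2) (at u)"
  shows "partial_u X u v = meridian_embedding v (x1 u) (y1 u) (r1 u)"
    and "partial_v X u v = r u *\<^sub>R parallel_direction v"
    and "partial_u (partial_u X) u v = meridian_embedding v x2 y2 r2"
    and "partial_v (partial_v X) u v = meridian_embedding v 0 0 (- r u)"
proof -
  have Xu: "partial_u X s v = meridian_embedding v (x1 s) (y1 s) (r1 s)" if "s \<in> I" for s
    unfolding partial_u_def X_def
    by (intro vector_derivative_at meridian_has_vector_derivative d1 that)
  have Xv: "partial_v X u = (\<lambda>t. r u *\<^sub>R parallel_direction t)"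
    unfolding partial_v_def X_def
    by (intro ext vector_derivative_at meridian_has_vector_derivative_angle)
  show "partial_u X u v = meridian_embedding v (x1 u) (y1 u) (r1 u)"
    by (rule Xu[OF \<open>u \<in> I\<close>])
  show "partial_v X u v = r u *\<^sub>R parallel_direction v"
    by (simp add: Xv)
  have "((\<lambda>s. partial_u X s v) has_vector_derivative meridian_embedding v x2 y2 r2) (at u)"
    by (rule has_vector_derivative_transform_within_open
        [OF meridian_has_vector_derivative[OF d2] \<open>open I\<close> \<open>u \<in> I\<close>]) (simp add: Xu)
  then show "partial_u (partial_u X) u v = meridian_embedding v x2 y2 r2"
    unfolding partial_u_def[of "partial_u X"] by (rule vector_derivative_at)
  have "((\<lambda>t. r u *\<^sub>R parallel_direction t) has_vector_derivative
      r u *\<^sub>R meridian_embedding v 0 0 (- 1)) (at v)"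
    using has_vector_derivative_scaleR[OF DERIV_const parallel_direction_has_vector_derivative]
    by simp
  then show "partial_v (partial_v X) u v = meridian_embedding v 0 0 (- r u)"
    unfolding partial_v_def[of "partial_v X"] Xv
    by (simp add: vector_derivative_at scaleR_meridian)
qed

text \<open>At a fixed point write \<open>\<gamma>' = (x1, y1, r1)\<close> and \<open>\<gamma>'' = (x2, y2, r2)\<close>.
  \<open>N1\<close> and \<open>N2\<close> are the rotated principal normal and binormal of the profile. They are
  orthogonal to \<open>X\<^sub>u\<close> because they are so in three-space, and to \<open>X\<^sub>v\<close> because every rotated
  vector is. That the binormal is a unit vector is Lagrange's identity
  \<open>\<bar>\<gamma>' \<times> \<gamma>''\<bar>\<^sup>2 = \<bar>\<gamma>'\<bar>\<^sup>2 \<bar>\<gamma>''\<bar>\<^sup>2 - (\<gamma>' \<bullet> \<gamma>'')\<^sup>2\<close>.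
  Meridians and parallels are orthogonal, so the mean curvature vector is half the sum of the
  normal parts of \<open>X\<^sub>u\<^sub>u\<close> and of \<open>X\<^sub>v\<^sub>v / r\<^sup>2\<close>; the first is \<open>k N1\<close> since
  \<open>\<gamma>''\<close> is a multiple of the principal normal.\<close>

lemma rotation_mean_curvature:
  fixes k x1 y1 r1 x2 y2 r2 r u v :: real
  assumes Xu: "partial_u X u v = meridian_embedding v x1 y1 r1"
    and Xv: "partial_v X u v = r *\<^sub>R parallel_direction v"
    and Xuu: "partial_u (partial_u X) u v = meridian_embedding v x2 y2 r2"
    and Xvv: "partial_v (partial_v X) u v = meridian_embedding v 0 0 (- r)"
    and unit: "x1\<^sup>2 + y1\<^sup>2 + r1\<^sup>2 = 1" and orth: "x1 * x2 + y1 * y2 + r1 * r2 = 0"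
    and k: "k\<^sup>2 = x2\<^sup>2 + y2\<^sup>2 + r2\<^sup>2" "k \<noteq> 0" and "r \<noteq> 0"
    and N1: "N1 u v = (1 / k) *\<^sub>R meridian_embedding v x2 y2 r2"
    and N2: "N2 u v = (1 / k) *\<^sub>R meridian_embedding v (y1 * r2 - r1 * y2) (r1 * x2 - x1 * r2)
                                          (x1 * y2 - y1 * x2)"
  shows "W2 X u v = r\<^sup>2"
    and "orthonormal_normal_frame X N1 N2 u v"
    and "mean_curvature_vector X N1 N2 u v =
       (1 / 2) *\<^sub>R ((k - r2 / (k * r)) *\<^sub>R N1 u v
                    - ((x1 * y2 - y1 * x2) / (k * r)) *\<^sub>R N2 u v)"
proof -
  note products = meridian_inner_meridian parallel_direction_inner_meridian norm_parallel_direction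
    inner_commute[of "meridian_embedding v _ _ _" "parallel_direction v"]
  have g: "g11 X u v = 1" "g12 X u v = 0" "g22 X u v = r\<^sup>2"
    using unit by (simp_all add: g11_def g12_def g22_def Xu Xv products power2_eq_square)
  then show W2: "W2 X u v = r\<^sup>2"
    by (simp add: W2_def)
  have lagrange: "(y1 * r2 - r1 * y2)\<^sup>2 + (r1 * x2 - x1 * r2)\<^sup>2 + (x1 * y2 - y1 * x2)\<^sup>2 = k\<^sup>2"
  proof -
    have "(y1 * r2 - r1 * y2)\<^sup>2 + (r1 * x2 - x1 * r2)\<^sup>2 + (x1 * y2 - y1 * x2)\<^sup>2 =
        (x1\<^sup>2 + y1\<^sup>2 + r1\<^sup>2) * (x2\<^sup>2 + y2\<^sup>2 + r2\<^sup>2) - (x1 * x2 + y1 * y2 + r1 * r2)\<^sup>2"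
      by algebra
    then show ?thesis by (simp add: unit orth k)
  qed
  have N1_unit: "N1 u v \<bullet> N1 u v = 1"
    using k(2) by (simp add: N1 products flip: power2_eq_square k(1))
  have N2_unit: "N2 u v \<bullet> N2 u v = 1"
    using k(2) by (simp add: N2 products lagrange flip: power2_eq_square)
  have N1_N2: "N1 u v \<bullet> N2 u v = 0"
    by (simp add: N1 N2 products algebra_simps)
  have Xu_N: "partial_u X u v \<bullet> N1 u v = 0" "partial_u X u v \<bullet> N2 u v = 0"
    using orth by (simp_all add: Xu N1 N2 products algebra_simps)
  have Xv_N: "partial_v X u v \<bullet> N1 u v = 0" "partial_v X u v \<bullet> N2 u v = 0"
    by (simp_all add: Xv N1 N2 products)
  show "orthonormal_normal_frame X N1 N2 u v"
    using N1_unit N2_unit N1_N2 Xu_N Xv_N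
    by (simp add: orthonormal_normal_frame_def norm_eq_1)
  have Xuu_N1: "partial_u (partial_u X) u v = k *\<^sub>R N1 u v"
    using k(2) by (simp add: Xuu N1)
  have L11: "L11 X N1 u v = k" "L11 X N2 u v = 0"
    by (simp_all add: L11_def Xuu_N1 N1_unit N1_N2)
  have L22: "L22 X N1 u v = - (r * r2 / k)"
      "L22 X N2 u v = - (r * (x1 * y2 - y1 * x2) / k)"
    by (simp_all add: L22_def Xvv N1 N2 products)
  have coeffs: "(k * r\<^sup>2 - r * r2 / k) / (2 * r\<^sup>2) = (k - r2 / (k * r)) / 2"
      "- (r * m / k) / (2 * r\<^sup>2) = - (m / (k * r)) / 2" for m
    using k(2) \<open>r \<noteq> 0\<close> by (simp_all add: field_simps power2_eq_square)
  have "mean_curvature_vector X N1 N2 u v =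
      ((k * r\<^sup>2 - r * r2 / k) / (2 * r\<^sup>2)) *\<^sub>R N1 u v
      + (- (r * (x1 * y2 - y1 * x2) / k) / (2 * r\<^sup>2)) *\<^sub>R N2 u v"
    by (simp add: mean_curvature_vector_def W2 g L11 L22 scaleR_diff_right)
  also have "\<dots> = (1 / 2) *\<^sub>R ((k - r2 / (k * r)) *\<^sub>R N1 u v
                    - ((x1 * y2 - y1 * x2) / (k * r)) *\<^sub>R N2 u v)"
    unfolding coeffs by (simp add: scaleR_diff_right)
  finally show "mean_curvature_vector X N1 N2 u v =
      (1 / 2) *\<^sub>R ((k - r2 / (k * r)) *\<^sub>R N1 u v
                    - ((x1 * y2 - y1 * x2) / (k * r)) *\<^sub>R N2 u v)" .
qed

section \<open>The profile curve\<close>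

lemma phi_differentiable:
  assumes "1 - l\<^sup>2 / c\<^sup>2 * (sin (u / c))\<^sup>2 > 0"
  shows "(phi c l has_real_derivative deriv (phi c l) u) (at u)"
proof -
  have "((\<lambda>u. 1 - a * (sin (u * b))\<^sup>2) has_real_derivative
      - (a * (2 * sin (u * b) * (cos (u * b) * b)))) (at u)" for a b :: real
    by (auto intro!: derivative_eq_intros)
  from DERIV_chain2[OF DERIV_real_sqrt this[of "l\<^sup>2 / c\<^sup>2" "1 / c"]]
  have "phi c l field_differentiable at u"
    using assms unfolding phi_def[abs_def] field_differentiable_def by auto
  then show ?thesis
    by (simp add: DERIV_deriv_iff_field_differentiable)
qed

lemma smooth_on_open_imp_DERIV_deriv:
  assumes "smooth_on_open S f" "u \<in> S"
  shows "(f has_real_derivative deriv f u) (at u)"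
proof -
  have "open S" and "(deriv ^^ 0) f differentiable_on S"
    using assms(1) unfolding smooth_on_open_def by blast+
  then show ?thesis
    using assms(2)
    by (simp add: DERIV_deriv_iff_real_differentiable differentiable_on_eq_differentiable_at)
qed

lemma orthogonal_to_derivative_of_unit_speed:
  fixes x1 y1 r1 :: "real \<Rightarrow> real"
  assumes "open I" "u \<in> I"
    and unit: "\<And>s. s \<in> I \<Longrightarrow> (x1 s)\<^sup>2 + (y1 s)\<^sup>2 + (r1 s)\<^sup>2 = 1"
    and d: "(x1 has_real_derivative x2) (at u)" "(y1 has_real_derivative y2) (at u)"
      "(r1 has_real_derivative r2) (at u)"
  shows "x1 u * x2 + y1 u * y2 + r1 u * r2 = 0"
proof -
  have "((\<lambda>s. (x1 s)\<^sup>2 + (y1 s)\<^sup>2 + (r1 s)\<^sup>2) has_real_derivative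
      2 * (x1 u * x2 + y1 u * y2 + r1 u * r2)) (at u)"
    using DERIV_add[OF DERIV_add[OF DERIV_power[OF d(1), of 2] DERIV_power[OF d(2), of 2]]
        DERIV_power[OF d(3), of 2]]
    by (simp add: algebra_simps)
  moreover have "((\<lambda>s. (x1 s)\<^sup>2 + (y1 s)\<^sup>2 + (r1 s)\<^sup>2) has_real_derivative 0) (at u)"
    by (rule has_field_derivative_transform_within_open[OF DERIV_const \<open>open I\<close> \<open>u \<in> I\<close>])
      (simp add: unit)
  ultimately show ?thesis
    using DERIV_unique by force
qed

theorem proposition7:
  fixes c l :: real and I :: "real set" and \<alpha> f1 f2 :: "real \<Rightarrow> real"
  assumes "c \<noteq> 0" and "l > 0"
    and "open I" and "is_interval I"
    and "\<And>u. u \<in> I \<Longrightarrow> cos (u / c) \<noteq> 0"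
    and "\<And>u. u \<in> I \<Longrightarrow> 1 - l\<^sup>2 / c\<^sup>2 * (sin (u / c))\<^sup>2 > 0"
    and "smooth_on_open I \<alpha>"
    and "spherical_coordinates c l \<alpha> I f1 f2"
  defines "X \<equiv> spherical_patch c l f1 f2"
    and "N1 \<equiv> normal1 c l f1 f2"
    and "N2 \<equiv> normal2 c l f1 f2"
    and "\<kappa> \<equiv> kappa c l f1 f2"
    and "\<kappa>1 \<equiv> kappa1 f1 f2"
    and "\<phi> \<equiv> phi c l"
  shows "\<forall>u\<in>I. \<forall>v.
     W2 X u v \<noteq> 0 \<and>
     orthonormal_normal_frame X N1 N2 u v \<and>
     mean_curvature_vector X N1 N2 u v =
       (1 / 2) *\<^sub>R ((((\<kappa> u)\<^sup>2 * c\<^sup>2 + 1) / (c\<^sup>2 * \<kappa> u)) *\<^sub>R N1 u v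
                    - (\<kappa>1 u / (\<kappa> u * l * cos (u / c))) *\<^sub>R N2 u v) \<and>
     \<kappa> u = sqrt ((deriv \<phi> u)\<^sup>2 + (\<phi> u)\<^sup>2 * ((deriv \<alpha> u)\<^sup>2 + 1 / c\<^sup>2)
                   + l\<^sup>2 / c ^ 4 * (1 - c\<^sup>2 / l\<^sup>2)) \<and>
     \<kappa>1 u = (\<phi> u)\<^sup>2 * deriv \<alpha> u"
proof (intro ballI allI)
  fix u v
  assume u: "u \<in> I"
  have c: "c \<noteq> 0" and l: "l \<noteq> 0" using assms(1,2) by auto
  define r where "r = (\<lambda>s. l * cos (s / c))"
  define r1 where "r1 = (\<lambda>s. - (l / c) * sin (s / c))"
  define r2 where "r2 = - (l / c\<^sup>2) * cos (u / c)"
  define x1 where "x1 = (\<lambda>s. \<phi> s * cos (\<alpha> s))"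
  define y1 where "y1 = (\<lambda>s. \<phi> s * sin (\<alpha> s))"
  define x2 where "x2 = deriv \<phi> u * cos (\<alpha> u) - \<phi> u * deriv \<alpha> u * sin (\<alpha> u)"
  define y2 where "y2 = deriv \<phi> u * sin (\<alpha> u) + \<phi> u * deriv \<alpha> u * cos (\<alpha> u)"

  have dphi: "(\<phi> has_real_derivative deriv \<phi> u) (at u)"
    unfolding \<phi>_def by (rule phi_differentiable[OF assms(6)[OF u]])
  have dalpha: "(\<alpha> has_real_derivative deriv \<alpha> u) (at u)"
    by (rule smooth_on_open_imp_DERIV_deriv[OF assms(7) u])
  have df: "(f1 has_real_derivative x1 s) (at s)" "(f2 has_real_derivative y1 s) (at s)"
    if "s \<in> I" for s
    using assms(8) that by (auto simp: spherical_coordinates_def x1_def y1_def \<phi>_def)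
  have dr: "(r has_real_derivative r1 s) (at s)" for s
    using DERIV_cmult[OF DERIV_chain2[OF DERIV_cos DERIV_cdivide[OF DERIV_ident, of c]], of l s]
    by (simp add: r_def r1_def)
  have d2: "(x1 has_real_derivative x2) (at u)" "(y1 has_real_derivative y2) (at u)"
      "(r1 has_real_derivative r2) (at u)"
    using DERIV_mult[OF dphi DERIV_chain2[OF DERIV_cos dalpha]]
      DERIV_mult[OF dphi DERIV_chain2[OF DERIV_sin dalpha]]
      DERIV_cmult[OF DERIV_chain2[OF DERIV_sin DERIV_cdivide[OF DERIV_ident, of c]], of "- (l / c)" u]
    by (simp_all add: x1_def y1_def r1_def x2_def y2_def r2_def algebra_simps power2_eq_square)
  have deriv_f: "deriv f1 s = x1 s" "deriv f2 s = y1 s" if "s \<in> I" for s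
    using df[OF that] by (auto intro: DERIV_imp_deriv)
  have "(deriv f1 has_real_derivative x2) (at u)" "(deriv f2 has_real_derivative y2) (at u)"
    using d2(1,2) by (auto intro: has_field_derivative_transform_within_open[OF _ assms(3) u]
        simp: deriv_f)
  then have deriv2_f: "deriv (deriv f1) u = x2" "deriv (deriv f2) u = y2"
    by (auto intro: DERIV_imp_deriv)

  have phi_sq: "(\<phi> s)\<^sup>2 = 1 - l\<^sup>2 / c\<^sup>2 * (sin (s / c))\<^sup>2" if "s \<in> I" for s
    using assms(6)[OF that] by (simp add: \<phi>_def phi_def)
  have unit: "(x1 s)\<^sup>2 + (y1 s)\<^sup>2 + (r1 s)\<^sup>2 = 1" if "s \<in> I" for s
  proof -
    have "(x1 s)\<^sup>2 + (y1 s)\<^sup>2 + (r1 s)\<^sup>2 =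
        (\<phi> s)\<^sup>2 * ((cos (\<alpha> s))\<^sup>2 + (sin (\<alpha> s))\<^sup>2) + l\<^sup>2 / c\<^sup>2 * (sin (s / c))\<^sup>2"
      unfolding x1_def y1_def r1_def
      by (simp add: power_mult_distrib power_divide distrib_left
          del: sin_cos_squared_add sin_cos_squared_add2)
    then show ?thesis by (simp add: phi_sq[OF that])
  qed
  have orth: "x1 u * x2 + y1 u * y2 + r1 u * r2 = 0"
    by (rule orthogonal_to_derivative_of_unit_speed[OF assms(3) u unit d2])

  have r2_sq: "r2\<^sup>2 = l\<^sup>2 / c ^ 4 * (cos (u / c))\<^sup>2"
    unfolding r2_def by (simp add: power_mult_distrib power_divide)
  have k: "\<kappa> u = sqrt (x2\<^sup>2 + y2\<^sup>2 + r2\<^sup>2)"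
    by (simp add: \<kappa>_def kappa_def deriv2_f r2_sq)
  have r0: "r u \<noteq> 0" and r2: "r2 = - r u / c\<^sup>2"
    using assms(5)[OF u] l by (auto simp: r_def r2_def)
  \<comment> \<open>The rotation radius \<open>r\<close> never vanishes, so its second derivative alone keeps the
    curvature positive.\<close>
  have "r2\<^sup>2 > 0" using r0 c by (simp add: r2)
  then have pos: "x2\<^sup>2 + y2\<^sup>2 + r2\<^sup>2 > 0"
    by (simp add: add_nonneg_pos)
  then have k_sq: "(\<kappa> u)\<^sup>2 = x2\<^sup>2 + y2\<^sup>2 + r2\<^sup>2" and k0: "\<kappa> u \<noteq> 0"
    by (auto simp: k)
  have k1: "\<kappa>1 u = x1 u * y2 - y1 u * x2"
    by (simp add: \<kappa>1_def kappa1_def deriv2_f deriv_f[OF u])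

  have X: "X = (\<lambda>u v. meridian_embedding v (f1 u) (f2 u) (r u))"
    by (simp add: fun_eq_iff X_def spherical_patch_def meridian_embedding_def r_def)
  have N1: "N1 u v = (1 / \<kappa> u) *\<^sub>R meridian_embedding v x2 y2 r2"
    by (simp add: N1_def normal1_def \<kappa>_def meridian_embedding_def deriv2_f r2_def)
  have N2: "N2 u v = (1 / \<kappa> u) *\<^sub>R meridian_embedding v (y1 u * r2 - r1 u * y2) (r1 u * x2 - x1 u * r2)
                                                   (x1 u * y2 - y1 u * x2)"
    unfolding N2_def normal2_def meridian_embedding_def k1[symmetric]
    by (simp add: \<kappa>_def \<kappa>1_def deriv2_f deriv_f[OF u] r1_def r2_def mult_ac)
  have partials: "partial_u X u v = meridian_embedding v (x1 u) (y1 u) (r1 u)"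
      "partial_v X u v = r u *\<^sub>R parallel_direction v"
      "partial_u (partial_u X) u v = meridian_embedding v x2 y2 r2"
      "partial_v (partial_v X) u v = meridian_embedding v 0 0 (- r u)"
    unfolding X by (rule rotation_partial_derivatives[OF assms(3) u df dr d2]; assumption)+
  note mean = rotation_mean_curvature
    [where X = X and u = u and v = v and ?N1.0 = N1 and ?N2.0 = N2,
      OF partials unit[OF u] orth k_sq k0 r0 N1 N2]

  have coeff: "\<kappa> u - r2 / (\<kappa> u * r u) = ((\<kappa> u)\<^sup>2 * c\<^sup>2 + 1) / (c\<^sup>2 * \<kappa> u)"
    using k0 r0 c by (simp add: r2 field_simps power2_eq_square)
  have k1_eq: "\<kappa>1 u = (\<phi> u)\<^sup>2 * deriv \<alpha> u"
  proof -
    have "\<kappa>1 u = (\<phi> u)\<^sup>2 * deriv \<alpha> u * ((cos (\<alpha> u))\<^sup>2 + (sin (\<alpha> u))\<^sup>2)"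
      unfolding k1 x1_def y1_def x2_def y2_def by algebra
    then show ?thesis by simp
  qed
  have k_eq: "\<kappa> u = sqrt ((deriv \<phi> u)\<^sup>2 + (\<phi> u)\<^sup>2 * ((deriv \<alpha> u)\<^sup>2 + 1 / c\<^sup>2)
                   + l\<^sup>2 / c ^ 4 * (1 - c\<^sup>2 / l\<^sup>2))"
  proof -
    have "x2\<^sup>2 + y2\<^sup>2 =
        ((deriv \<phi> u)\<^sup>2 + (\<phi> u)\<^sup>2 * (deriv \<alpha> u)\<^sup>2) * ((cos (\<alpha> u))\<^sup>2 + (sin (\<alpha> u))\<^sup>2)"
      unfolding x2_def y2_def by algebra
    \<comment> \<open>As \<open>r'' = - r / c\<^sup>2\<close> and \<open>r\<^sup>2 + c\<^sup>2 r'\<^sup>2 = l\<^sup>2\<close>, the unit-speed relation turns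
      \<open>r''\<^sup>2\<close> into a function of \<open>\<phi>\<close>.\<close>
    moreover have "r2\<^sup>2 = (\<phi> u)\<^sup>2 / c\<^sup>2 + l\<^sup>2 / c ^ 4 * (1 - c\<^sup>2 / l\<^sup>2)"
      using c l unfolding r2_sq phi_sq[OF u] cos_squared_eq
      by (simp add: field_simps power2_eq_square power4_eq_xxxx)
    ultimately show ?thesis unfolding k by (simp add: distrib_left)
  qed
  have kr: "\<kappa> u * r u = \<kappa> u * l * cos (u / c)"
    by (simp add: r_def)
  note H = mean(3)[folded k1, unfolded coeff, unfolded kr]
  show "W2 X u v \<noteq> 0 \<and>
     orthonormal_normal_frame X N1 N2 u v \<and>
     mean_curvature_vector X N1 N2 u v =
       (1 / 2) *\<^sub>R ((((\<kappa> u)\<^sup>2 * c\<^sup>2 + 1) / (c\<^sup>2 * \<kappa> u)) *\<^sub>R N1 u v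
                    - (\<kappa>1 u / (\<kappa> u * l * cos (u / c))) *\<^sub>R N2 u v) \<and>
     \<kappa> u = sqrt ((deriv \<phi> u)\<^sup>2 + (\<phi> u)\<^sup>2 * ((deriv \<alpha> u)\<^sup>2 + 1 / c\<^sup>2)
                   + l\<^sup>2 / c ^ 4 * (1 - c\<^sup>2 / l\<^sup>2)) \<and>
     \<kappa>1 u = (\<phi> u)\<^sup>2 * deriv \<alpha> u"
    by (intro conjI mean(2) H k_eq k1_eq) (simp add: mean(1) r0)
qed

end
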